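(* Let $\mathbb{S}\in\{(\mathrm{SHerm}(n))^2,\mathbb{S}_e,\mathbb{S}_o\}$ and let $L(s)=A+sE$ be a regular pencil with $(A,E)\in\mathbb{S}$. If $\mathbb{S}=(\mathrm{SHerm}(n))^2$, then $$\delta_0^{\mathrm{SHerm}}(A,E)=\delta_0^{\mathrm{Herm}}(iA,iE)=\sqrt{\lambda_{\min}(A^*A+E^*E)}=\delta_0(A,E).$$ If $\mathbb{S}=\mathbb{S}_e$, then $$\delta_0^{\mathbb{S}_e}(A,E)=\delta_0^{\mathrm{Herm}}(A,iE)=\sqrt{\lambda_{\min}(A^*A+E^*E)}=\delta_0(A,E).$$ If $\mathbb{S}=\mathbb{S}_o$, then $$\delta_0^{\mathbb{S}_o}(A,E)=\delta_0^{\mathrm{Herm}}(iA,-E)=\sqrt{\lambda_{\min}(A^*A+E^*E)}=\delta_0(A,E).$$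
   Context: $\mathbb{C}^{n,n}$ is the set of complex $n\times n$ matrices; $\mathrm{Herm}(n)$ and $\mathrm{SHerm}(n)$ are the sets of $n\times n$ complex Hermitian and skew-Hermitian matrices. $\mathbb{S}_e=\mathrm{Herm}(n)\times\mathrm{SHerm}(n)$ ($*$-even pairs) and $\mathbb{S}_o=\mathrm{SHerm}(n)\times\mathrm{Herm}(n)$ ($*$-odd pairs). A pencil $A+sE$ is regular if $A+\lambda E$ is invertible for some $\lambda\in\mathbb{C}$. $\|\cdot\|$ is the spectral norm and $\lambda_{\min}(H)$ is the smallest eigenvalue of a Hermitian matrix $H$. For $\mathbb{S}\subseteq(\mathbb{C}^{n,n})^2$ and $(A,E)\in\mathbb{S}$ the structured distance to a common null space is $$\delta_0^{\mathbb{S}}(A,E)=\inf\Big\{\sqrt{\|\Delta_A\|^2+\|\Delta_E\|^2}\;:\;(\Delta_A,\Delta_E)\in\mathbb{S},\ \ker(A-\Delta_A)\cap\ker(E-\Delta_E)\neq\{0\}\Big\}.$$ $\delta_0^{\mathrm{Herm}}$, $\delta_0^{\mathrm{SHerm}}$ and $\delta_0$ denote $\delta_0^{\mathbb{S}}$ for $\mathbb{S}=(\mathrm{Herm}(n))^2$, $(\mathrm{SHerm}(n))^2$ and $(\mathbb{C}^{n,n})^2$, respectively. *)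

theory Defs
  imports "HOL-Analysis.Analysis"
begin

definition conj_transpose :: "complex^'n^'m \<Rightarrow> complex^'m^'n" where
  "conj_transpose A = (\<chi> i j. cnj (A $ j $ i))"

(* scaleR only provides real multiples of matrices, and c *s A would need a
   multiplication between c and the rows of A *)
definition cscale :: "complex \<Rightarrow> complex^'n^'m \<Rightarrow> complex^'n^'m" where
  "cscale c A = (\<chi> i j. c * A $ i $ j)"

definition Herm :: "(complex^'n^'n) set" where
  "Herm = {A. conj_transpose A = A}"

definition SHerm :: "(complex^'n^'n) set" where
  "SHerm = {A. conj_transpose A = - A}"

definition S_even :: "((complex^'n^'n) \<times> (complex^'n^'n)) set" where
  "S_even = Herm \<times> SHerm"

definition S_odd :: "((complex^'n^'n) \<times> (complex^'n^'n)) set" where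
  "S_odd = SHerm \<times> Herm"

definition regular_pencil :: "complex^'n^'n \<Rightarrow> complex^'n^'n \<Rightarrow> bool" where
  "regular_pencil A E \<longleftrightarrow> (\<exists>l. invertible (A + cscale l E))"

(* The norm on complex^'n is the Euclidean one. The norm on the matrix type
   complex^'n^'n itself is the Frobenius norm, hence the operator norm here. *)
definition spectral_norm :: "complex^'n^'n \<Rightarrow> real" where
  "spectral_norm A = onorm ((*v) A)"

definition eigenvalue :: "complex^'n^'n \<Rightarrow> complex \<Rightarrow> bool" where
  "eigenvalue A c \<longleftrightarrow> (\<exists>x. x \<noteq> 0 \<and> A *v x = c *s x)"

(* Only used for Hermitian H, whose eigenvalues are all real. *)
definition lambda_min :: "complex^'n^'n \<Rightarrow> real" where
  "lambda_min H = (LEAST l. eigenvalue H (complex_of_real l))"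

definition mat_ker :: "complex^'n^'n \<Rightarrow> (complex^'n) set" where
  "mat_ker A = {x. A *v x = 0}"

(* For (A, E) in S the set below contains the value at (DA, DE) = (A, E), so the
   real-valued Inf is that of a nonempty set bounded below by 0. *)
definition delta0 ::
  "((complex^'n^'n) \<times> (complex^'n^'n)) set \<Rightarrow> complex^'n^'n \<Rightarrow> complex^'n^'n \<Rightarrow> real" where
  "delta0 S A E = Inf {sqrt ((spectral_norm DA)\<^sup>2 + (spectral_norm DE)\<^sup>2) | DA DE.
     (DA, DE) \<in> S \<and> mat_ker (A - DA) \<inter> mat_ker (E - DE) \<noteq> {0}}"

end

theory Submission
  imports Defs
begin

text \<open>
  For every \<open>S\<close> in question the distance is governed by the Rayleigh quotient of
  \<open>M = A\<^sup>* A + E\<^sup>* E\<close>, whose quadratic form is \<open>\<parallel>A x\<parallel>\<^sup>2 + \<parallel>E x\<parallel>\<^sup>2\<close>.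

  The lower bound holds for arbitrary perturbations. If \<open>x \<noteq> 0\<close> lies in both \<open>ker (A - D\<^sub>A)\<close> and
  \<open>ker (E - D\<^sub>E)\<close>, then \<open>D\<^sub>A x = A x\<close> and \<open>D\<^sub>E x = E x\<close>, so
  \<open>\<lambda>\<^sub>m\<^sub>i\<^sub>n(M) \<parallel>x\<parallel>\<^sup>2 \<le> \<parallel>A x\<parallel>\<^sup>2 + \<parallel>E x\<parallel>\<^sup>2 \<le> (\<parallel>D\<^sub>A\<parallel>\<^sup>2 + \<parallel>D\<^sub>E\<parallel>\<^sup>2) \<parallel>x\<parallel>\<^sup>2\<close>.

  For the upper bound let \<open>x\<close> be a unit eigenvector of \<open>M\<close> for its smallest eigenvalue. It
  suffices to find perturbations of the prescribed structure that agree with \<open>A\<close> and \<open>E\<close> at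
  the single vector \<open>x\<close> and whose spectral norms do not exceed \<open>\<parallel>A x\<parallel>\<close> and \<open>\<parallel>E x\<parallel>\<close>
  (\<open>has_minimal_interpolants\<close>). For a Hermitian \<open>A\<close> this is possible because \<open>x\<^sup>* A x\<close> is
  real: two unit vectors with real inner product are exchanged by a Householder reflection, which
  is Hermitian and unitary, so \<open>\<parallel>A x\<parallel>\<close> times the reflection that takes \<open>x\<close> to
  \<open>A x / \<parallel>A x\<parallel>\<close> does it (\<open>Herm_has_minimal_interpolants\<close>). Multiplication by \<open>\<i>\<close> carries
  this over to skew-Hermitian matrices. Multiplying \<open>A\<close> or \<open>E\<close> by a number of modulus one
  leaves \<open>M\<close> unchanged, so all the distances in the theorem are the same number.
\<close>

section \<open>The Hermitian inner product\<close>

text \<open>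
  The inner product \<open>x \<bullet> y\<close> on \<open>complex^'n\<close> is only the real part of the Hermitian one. It
  suffices for the Rayleigh quotient, but a complex reflection uses the coefficient \<open>v\<^sup>* z\<close> itself.
\<close>
definition hinner :: "complex^'n \<Rightarrow> complex^'n \<Rightarrow> complex" where
  "hinner x y = (\<Sum>i\<in>UNIV. cnj (x $ i) * y $ i)"

lemma Re_hinner: "Re (hinner x y) = x \<bullet> y"
  by (simp add: hinner_def inner_vec_def inner_complex_def Re_sum)

lemma hinner_commute: "hinner x y = cnj (hinner y x)"
  by (simp add: hinner_def cnj_sum mult.commute)

lemma hinner_diff_left: "hinner (x - y) z = hinner x z - hinner y z"
  by (simp add: hinner_def algebra_simps sum_subtractf)

lemma hinner_smult_left: "hinner (c *s x) y = cnj c * hinner x y"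
  by (simp add: hinner_def sum_distrib_left algebra_simps)

lemma scaleR_eq_smult: "c *\<^sub>R x = of_real c *s (x :: complex^'n)"
  by (simp add: vec_eq_iff scaleR_conv_of_real[where 'a = complex])

lemma hinner_self: "hinner x x = of_real ((norm x)\<^sup>2)"
proof (rule complex_eqI)
  show "Re (hinner x x) = Re (of_real ((norm x)\<^sup>2))"
    by (simp add: Re_hinner power2_norm_eq_inner)
  show "Im (hinner x x) = Im (of_real ((norm x)\<^sup>2))"
    using arg_cong[OF hinner_commute[of x x], of Im] by simp
qed

lemma norm_smult: "norm (c *s x) = cmod c * norm (x :: complex^'n)"
  by (simp add: norm_vec_def norm_mult L2_set_right_distrib)

lemma hinner_conj_transpose_mult: "hinner (conj_transpose A *v x) y = hinner x (A *v y)"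
proof -
  have "hinner (conj_transpose A *v x) y = (\<Sum>i\<in>UNIV. \<Sum>j\<in>UNIV. A $ j $ i * cnj (x $ j) * y $ i)"
    by (simp add: hinner_def conj_transpose_def matrix_vector_mult_def cnj_sum sum_distrib_right)
  also have "\<dots> = (\<Sum>j\<in>UNIV. \<Sum>i\<in>UNIV. A $ j $ i * cnj (x $ j) * y $ i)"
    by (rule sum.swap)
  also have "\<dots> = hinner x (A *v y)"
    by (simp add: hinner_def matrix_vector_mult_def sum_distrib_left algebra_simps)
  finally show ?thesis .
qed

lemma inner_conj_transpose_mult: "(conj_transpose A *v x) \<bullet> y = x \<bullet> (A *v y)"
  by (metis Re_hinner hinner_conj_transpose_mult)

lemma Herm_hinner_real:
  assumes "A \<in> Herm"
  shows "Im (hinner (A *v x) x) = 0"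
proof -
  have "hinner (A *v x) x = hinner x (A *v x)"
    using assms hinner_conj_transpose_mult[of A x x] by (simp add: Herm_def)
  then show ?thesis
    using arg_cong[OF hinner_commute[of "A *v x" x], of Im] by simp
qed

section \<open>Complex multiples and the spectral norm\<close>

lemma cscale_mult_vec: "cscale c A *v x = c *s (A *v x)"
  by (simp add: cscale_def matrix_vector_mult_def vec_eq_iff sum_distrib_left algebra_simps)

lemma cscale_i_in_Herm: "A \<in> SHerm \<Longrightarrow> cscale \<i> A \<in> Herm"
  by (simp add: Herm_def SHerm_def conj_transpose_def cscale_def vec_eq_iff)

lemma cscale_minus_i_in_SHerm: "A \<in> Herm \<Longrightarrow> cscale (- \<i>) A \<in> SHerm"
  by (simp add: Herm_def SHerm_def conj_transpose_def cscale_def vec_eq_iff)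

lemma uminus_in_Herm: "A \<in> Herm \<Longrightarrow> - A \<in> Herm"
  by (simp add: Herm_def conj_transpose_def vec_eq_iff)

lemma bounded_linear_mult_vec: "bounded_linear ((*v) (A :: complex^'n^'n))"
  by (simp add: linear_conv_bounded_linear[symmetric])

lemma norm_mult_vec_le_spectral_norm: "norm (A *v x) \<le> spectral_norm A * norm x"
  unfolding spectral_norm_def by (rule onorm[OF bounded_linear_mult_vec])

lemma spectral_norm_leI: "(\<And>z. norm (A *v z) \<le> b * norm z) \<Longrightarrow> spectral_norm A \<le> b"
  unfolding spectral_norm_def by (rule onorm_le)

lemma spectral_norm_nonneg: "0 \<le> spectral_norm A"
  unfolding spectral_norm_def by (rule onorm_pos_le[OF bounded_linear_mult_vec])

section \<open>Householder reflections\<close>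

text \<open>
  The reflection in the hyperplane orthogonal to \<open>v\<close>; for \<open>v = 0\<close> the formula gives the
  identity, so that \<open>v\<close> can be the difference of two vectors that may coincide.
\<close>
definition householder :: "complex^'n \<Rightarrow> complex^'n^'n" where
  "householder v =
    (\<chi> i j. (if i = j then 1 else 0) - of_real (2 / (norm v)\<^sup>2) * v $ i * cnj (v $ j))"

lemma householder_mult_vec:
  "householder v *v z = z - (2 / (norm v)\<^sup>2) *\<^sub>R (hinner v z *s v)"
proof -
  define c :: complex where "c = of_real (2 / (norm v)\<^sup>2)"
  have delta: "(\<Sum>j\<in>UNIV. (if i = j then 1 else 0) * z $ j) = z $ i" for i
    by (subst sum.remove[of _ i]) (auto intro!: sum.neutral)
  have "householder v *v z = z - c *s (hinner v z *s v)"
    unfolding householder_def c_def[symmetric]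
    by (simp add: matrix_vector_mult_def hinner_def vec_eq_iff left_diff_distrib sum_subtractf delta)
      (simp add: sum_distrib_left sum_distrib_right ac_simps)
  then show ?thesis
    by (simp add: c_def scaleR_eq_smult)
qed

lemma householder_in_Herm: "householder v \<in> Herm"
  by (simp add: householder_def Herm_def conj_transpose_def vec_eq_iff)

lemma norm_householder_mult_vec: "norm (householder v *v z) = norm z"
proof (cases "v = 0")
  case True
  then show ?thesis by (simp add: householder_mult_vec)
next
  case False
  define c where "c = 2 / (norm v)\<^sup>2"
  define w where "w = hinner v z *s v"
  have c: "c * (norm v)\<^sup>2 = 2"
    using False by (simp add: c_def)
  have "z \<bullet> w = (cmod (hinner v z))\<^sup>2"
    using Re_hinner[of w z]
    by (simp add: w_def hinner_smult_left inner_commute cmod_power2)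
      (simp add: power2_eq_square)
  moreover have "w \<bullet> w = (cmod (hinner v z))\<^sup>2 * (norm v)\<^sup>2"
    by (simp add: w_def power2_norm_eq_inner[symmetric] norm_smult power_mult_distrib)
  moreover have "(norm (z - c *\<^sub>R w))\<^sup>2 = (norm z)\<^sup>2 - 2 * c * (z \<bullet> w) + c * c * (w \<bullet> w)"
    by (simp add: power2_norm_eq_inner inner_diff inner_commute algebra_simps)
  ultimately have "(norm (z - c *\<^sub>R w))\<^sup>2
      = (norm z)\<^sup>2 - c * (cmod (hinner v z))\<^sup>2 * (2 - c * (norm v)\<^sup>2)"
    by (simp add: algebra_simps)
  then show ?thesis
    by (simp add: c householder_mult_vec flip: c_def w_def)
qed

text \<open>
  With \<open>v = x - u\<close> one has \<open>v\<^sup>* x = 1 - u\<^sup>* x\<close> and \<open>\<parallel>v\<parallel>\<^sup>2 = 2 - 2 Re (u\<^sup>* x)\<close>. The reflection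
  subtracts exactly one copy of \<open>v\<close> from \<open>x\<close> if and only if \<open>v\<^sup>* x\<close> is half of \<open>\<parallel>v\<parallel>\<^sup>2\<close>, which
  is why \<open>u\<^sup>* x\<close> has to be real.
\<close>
lemma householder_maps_unit_vector:
  assumes "norm x = 1" "norm u = 1" "Im (hinner u x) = 0"
  shows "householder (x - u) *v x = u"
proof (cases "x = u")
  case True
  then show ?thesis by (simp add: householder_mult_vec)
next
  case False
  have xx: "x \<bullet> x = 1" and uu: "u \<bullet> u = 1"
    using assms by (simp_all flip: power2_norm_eq_inner)
  have "(norm (x - u))\<^sup>2 = 2 - 2 * (u \<bullet> x)"
    by (simp add: power2_norm_eq_inner inner_diff inner_commute xx uu)
  moreover have "hinner (x - u) x = of_real (1 - u \<bullet> x)"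
    using assms by (simp add: hinner_diff_left hinner_self complex_eq_iff Re_hinner)
  ultimately have half: "hinner (x - u) x = of_real ((norm (x - u))\<^sup>2 / 2)"
    by simp
  have "(2 / (norm (x - u))\<^sup>2) *\<^sub>R (hinner (x - u) x *s (x - u)) = x - u"
    using False unfolding half scaleR_eq_smult by (simp add: vector_smult_assoc)
  then show ?thesis by (simp add: householder_mult_vec)
qed

section \<open>Structured interpolation at one vector\<close>

text \<open>
  The only property of a structure class that the distance formula uses: each member can be
  replaced, as far as its value at one unit vector is concerned, by a member whose norm is as
  small as that value permits.
\<close>
definition has_minimal_interpolants :: "(complex^'n^'n) set \<Rightarrow> bool" where
  "has_minimal_interpolants T \<longleftrightarrow>
    (\<forall>A\<in>T. \<forall>x. norm x = 1 \<longrightarrow> (\<exists>D\<in>T. D *v x = A *v x \<and> spectral_norm D \<le> norm (A *v x)))"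

lemma Herm_has_minimal_interpolants: "has_minimal_interpolants Herm"
  unfolding has_minimal_interpolants_def
proof (intro ballI allI impI)
  fix A :: "complex^'n^'n" and x :: "complex^'n"
  assume A: "A \<in> Herm" and x: "norm x = 1"
  define b where "b = norm (A *v x)"
  have b_nonneg: "0 \<le> b" by (simp add: b_def)
  show "\<exists>D\<in>Herm. D *v x = A *v x \<and> spectral_norm D \<le> norm (A *v x)"
  proof (cases "b = 0")
    case True
    have "(0 :: complex^'n^'n) \<in> Herm"
      by (simp add: Herm_def conj_transpose_def vec_eq_iff)
    moreover have "spectral_norm (0 :: complex^'n^'n) \<le> b"
      using True by (intro spectral_norm_leI) simp
    ultimately show ?thesis
      using True by (intro bexI[of _ 0]) (auto simp: b_def)
  next
    case False
    define u where "u = (1 / b) *\<^sub>R (A *v x)"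
    define R where "R = householder (x - u)"
    have "norm u = 1"
      using False by (simp add: u_def b_def)
    moreover have "Im (hinner u x) = 0"
      by (simp add: u_def scaleR_eq_smult hinner_smult_left Herm_hinner_real[OF A])
    ultimately have Rx: "R *v x = u"
      unfolding R_def using x by (intro householder_maps_unit_vector)
    have R_isometry: "norm (R *v z) = norm z" for z
      by (simp add: R_def norm_householder_mult_vec)
    have D: "cscale (of_real b) R *v z = b *\<^sub>R (R *v z)" for z
      by (simp add: cscale_mult_vec scaleR_eq_smult)
    have "cscale (of_real b) R \<in> Herm"
      using householder_in_Herm[of "x - u"]
      by (simp add: R_def Herm_def conj_transpose_def cscale_def vec_eq_iff)
    moreover have "cscale (of_real b) R *v x = A *v x"
      using False by (simp add: D Rx u_def)
    moreover have "spectral_norm (cscale (of_real b) R) \<le> b"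
      by (rule spectral_norm_leI) (simp add: D R_isometry b_nonneg)
    ultimately show ?thesis
      by (auto simp: b_def)
  qed
qed

lemma SHerm_has_minimal_interpolants: "has_minimal_interpolants SHerm"
  unfolding has_minimal_interpolants_def
proof (intro ballI allI impI)
  fix A :: "complex^'n^'n" and x :: "complex^'n"
  assume A: "A \<in> SHerm" and x: "norm x = 1"
  obtain D where D: "D \<in> Herm" "D *v x = cscale \<i> A *v x"
      "spectral_norm D \<le> norm (cscale \<i> A *v x)"
    using Herm_has_minimal_interpolants cscale_i_in_Herm[OF A] x
    unfolding has_minimal_interpolants_def by blast
  have "cscale (- \<i>) D *v x = A *v x"
    by (simp add: cscale_mult_vec D(2) vec_eq_iff flip: mult.assoc)
  moreover have "spectral_norm (cscale (- \<i>) D) \<le> norm (A *v x)"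
  proof (rule spectral_norm_leI)
    fix z
    have "norm (cscale (- \<i>) D *v z) \<le> spectral_norm D * norm z"
      using norm_mult_vec_le_spectral_norm[of D z] by (simp add: cscale_mult_vec norm_smult)
    also have "\<dots> \<le> norm (A *v x) * norm z"
      using D(3) by (intro mult_right_mono) (simp_all add: cscale_mult_vec norm_smult)
    finally show "norm (cscale (- \<i>) D *v z) \<le> norm (A *v x) * norm z" .
  qed
  ultimately show "\<exists>D\<in>SHerm. D *v x = A *v x \<and> spectral_norm D \<le> norm (A *v x)"
    using cscale_minus_i_in_SHerm[OF D(1)] by blast
qed

section \<open>The smallest eigenvalue as a minimum\<close>

lemma inner_gram_mult:
  "((conj_transpose A ** A + conj_transpose E ** E) *v x) \<bullet> y
    = (A *v x) \<bullet> (A *v y) + (E *v x) \<bullet> (E *v y)"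
  by (simp add: matrix_vector_mult_add_rdistrib inner_add_left inner_conj_transpose_mult
      flip: matrix_vector_mul_assoc)

lemma nonneg_quadratic_imp_linear_coeff_zero:
  fixes b c :: real
  assumes "\<And>t. 0 \<le> 2 * t * b + t\<^sup>2 * c"
  shows "b = 0"
proof (rule ccontr)
  assume b: "b \<noteq> 0"
  define d where "d = \<bar>c\<bar> + 1"
  have d: "d > 0" "c < d" "c / d < 2" by (auto simp: d_def field_simps)
  \<comment> \<open>At \<open>t = - b / d\<close> the quadratic is negative, since \<open>c < d\<close>.\<close>
  have "2 * (- b / d) * b + (- b / d)\<^sup>2 * c = (b\<^sup>2 / d) * (c / d - 2)"
    using d by (simp add: field_simps power2_eq_square)
  also have "\<dots> < 0"
    using b d by (intro mult_pos_neg) auto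
  finally show False
    using assms[of "- b / d"] by simp
qed

text \<open>
  The unit sphere is compact, so the quadratic form \<open>\<parallel>A x\<parallel>\<^sup>2 + \<parallel>E x\<parallel>\<^sup>2\<close> attains its minimum
  \<open>m\<close> there. Its first variation vanishes at a minimizer, which makes the minimizer an eigenvector
  for \<open>m\<close>; any other real eigenvalue is a value of the form at a unit vector, hence at least \<open>m\<close>.
\<close>
lemma lambda_min_gram:
  fixes A E :: "complex^'n^'n"
  defines "l \<equiv> lambda_min (conj_transpose A ** A + conj_transpose E ** E)"
  obtains x where "norm x = 1" "(norm (A *v x))\<^sup>2 + (norm (E *v x))\<^sup>2 = l"
    and "\<And>y. l * (norm y)\<^sup>2 \<le> (norm (A *v y))\<^sup>2 + (norm (E *v y))\<^sup>2"
proof -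
  define M where "M = conj_transpose A ** A + conj_transpose E ** E"
  define q where "q x = (norm (A *v x))\<^sup>2 + (norm (E *v x))\<^sup>2" for x
  have qM: "q x = (M *v x) \<bullet> x" for x
    by (simp add: q_def M_def inner_gram_mult power2_norm_eq_inner)
  have "continuous_on (sphere 0 1) q"
    unfolding q_def by (intro continuous_intros linear_continuous_on bounded_linear_mult_vec)
  moreover have "sphere (0 :: complex^'n) 1 \<noteq> {}"
    by simp
  ultimately obtain x0 where "x0 \<in> sphere 0 1" and x0_min: "\<forall>y\<in>sphere 0 1. q x0 \<le> q y"
    using continuous_attains_inf[OF compact_sphere] by blast
  then have x0: "norm x0 = 1" "x0 \<noteq> 0" by auto
  define m where "m = q x0"
  have ge: "m * (norm y)\<^sup>2 \<le> q y" for y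
  proof (cases "y = 0")
    case True
    then show ?thesis by (simp add: q_def)
  next
    case False
    define u where "u = (1 / norm y) *\<^sub>R y"
    have "y = norm y *\<^sub>R u" "u \<in> sphere 0 1"
      using False by (auto simp: u_def)
    moreover have "q (c *\<^sub>R u) = c\<^sup>2 * q u" for c
      by (simp add: q_def linear_scale[OF matrix_vector_mul_linear] power_mult_distrib algebra_simps)
    ultimately have "q y = (norm y)\<^sup>2 * q u" "m \<le> q u"
      using x0_min unfolding m_def by metis+
    then show ?thesis
      by (simp add: mult.commute mult_right_mono)
  qed
  define r where "r = M *v x0 - m *\<^sub>R x0"
  have "r \<bullet> r = 0"
  proof (rule nonneg_quadratic_imp_linear_coeff_zero)
    fix t :: real
    have M_sym: "(M *v r) \<bullet> x0 = (M *v x0) \<bullet> r"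
      unfolding M_def inner_gram_mult by (simp add: inner_commute)
    have "q (x0 + t *\<^sub>R r) = m + 2 * t * ((M *v x0) \<bullet> r) + t\<^sup>2 * q r"
      unfolding m_def qM
      by (simp add: matrix_vector_right_distrib linear_scale[OF matrix_vector_mul_linear] inner_add M_sym
          power2_eq_square algebra_simps)
    moreover have "(norm (x0 + t *\<^sub>R r))\<^sup>2 = 1 + 2 * t * (x0 \<bullet> r) + t\<^sup>2 * (norm r)\<^sup>2"
      using x0(1) unfolding power2_norm_eq_inner norm_eq_1
      by (simp add: inner_add inner_commute power2_eq_square algebra_simps)
    moreover have "(M *v x0) \<bullet> r = r \<bullet> r + m * (x0 \<bullet> r)"
      unfolding r_def by (simp add: inner_diff inner_commute algebra_simps)
    ultimately show "0 \<le> 2 * t * (r \<bullet> r) + t\<^sup>2 * (q r - m * (norm r)\<^sup>2)"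
      using ge[of "x0 + t *\<^sub>R r"] by (simp add: algebra_simps)
  qed
  then have "M *v x0 = m *\<^sub>R x0"
    by (simp add: r_def)
  then have "eigenvalue M (of_real m)"
    using x0 unfolding eigenvalue_def
    by (auto simp: scaleR_eq_smult)
  moreover have "m \<le> k" if "eigenvalue M (of_real k)" for k
  proof -
    from that obtain x where x: "x \<noteq> 0" "M *v x = of_real k *s x"
      unfolding eigenvalue_def by blast
    then have "q x = k * (norm x)\<^sup>2"
      by (simp add: qM power2_norm_eq_inner flip: scaleR_eq_smult)
    with ge[of x] x show ?thesis
      by simp
  qed
  ultimately have "l = m"
    unfolding l_def lambda_min_def M_def by (intro Least_equality)
  with x0 ge show thesis
    by (intro that[of x0]) (simp_all add: m_def q_def)
qed

section \<open>The distance formula\<close>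

text \<open>
  Allowing a superset of \<open>T \<times> U\<close> lets the formula cover unstructured perturbations as well: the
  lower bound holds for all perturbations, and the optimal structured one is admissible.
\<close>
lemma delta0_eq_sqrt_lambda_min:
  fixes A E :: "complex^'n^'n"
  assumes "A \<in> T" "E \<in> U" "has_minimal_interpolants T" "has_minimal_interpolants U" "T \<times> U \<subseteq> S"
  shows "delta0 S A E = sqrt (lambda_min (conj_transpose A ** A + conj_transpose E ** E))"
proof -
  define l where "l = lambda_min (conj_transpose A ** A + conj_transpose E ** E)"
  obtain x where x: "norm x = 1" "(norm (A *v x))\<^sup>2 + (norm (E *v x))\<^sup>2 = l"
    and le: "\<And>y. l * (norm y)\<^sup>2 \<le> (norm (A *v y))\<^sup>2 + (norm (E *v y))\<^sup>2"
    using lambda_min_gram[of A E] unfolding l_def by blast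
  have lower: "sqrt l \<le> sqrt ((spectral_norm DA)\<^sup>2 + (spectral_norm DE)\<^sup>2)"
    if ker: "mat_ker (A - DA) \<inter> mat_ker (E - DE) \<noteq> {0}" for DA DE
  proof -
    have "0 \<in> mat_ker (A - DA) \<inter> mat_ker (E - DE)"
      by (simp add: mat_ker_def)
    with ker obtain y where y: "y \<noteq> 0" "A *v y = DA *v y" "E *v y = DE *v y"
      by (auto simp: mat_ker_def matrix_vector_mult_diff_rdistrib)
    have "l * (norm y)\<^sup>2 \<le> (norm (DA *v y))\<^sup>2 + (norm (DE *v y))\<^sup>2"
      using le[of y] y by simp
    also have "\<dots> \<le> (spectral_norm DA * norm y)\<^sup>2 + (spectral_norm DE * norm y)\<^sup>2"
      by (intro add_mono power_mono norm_mult_vec_le_spectral_norm) simp_all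
    also have "\<dots> = ((spectral_norm DA)\<^sup>2 + (spectral_norm DE)\<^sup>2) * (norm y)\<^sup>2"
      by (simp add: power_mult_distrib algebra_simps)
    finally show ?thesis
      using y by simp
  qed
  obtain DA where DA: "DA \<in> T" "DA *v x = A *v x" "spectral_norm DA \<le> norm (A *v x)"
    using assms x unfolding has_minimal_interpolants_def by blast
  obtain DE where DE: "DE \<in> U" "DE *v x = E *v x" "spectral_norm DE \<le> norm (E *v x)"
    using assms x unfolding has_minimal_interpolants_def by blast
  have "x \<in> mat_ker (A - DA) \<inter> mat_ker (E - DE)" "x \<noteq> 0"
    using DA DE x by (auto simp: mat_ker_def matrix_vector_mult_diff_rdistrib)
  then have ker: "mat_ker (A - DA) \<inter> mat_ker (E - DE) \<noteq> {0}"
    by blast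
  have "(spectral_norm DA)\<^sup>2 + (spectral_norm DE)\<^sup>2 \<le> l"
    unfolding x(2)[symmetric] using DA DE
    by (intro add_mono power_mono spectral_norm_nonneg)
  with lower[OF ker]
  have "sqrt l = sqrt ((spectral_norm DA)\<^sup>2 + (spectral_norm DE)\<^sup>2)"
    by simp
  moreover have "(DA, DE) \<in> S"
    using DA DE assms by blast
  ultimately show ?thesis
    unfolding delta0_def l_def[symmetric] using lower ker
    by (intro cInf_eq_minimum) blast+
qed

lemma gram_cscale:
  assumes "cmod c = 1"
  shows "conj_transpose (cscale c A) ** cscale c A = conj_transpose A ** A"
proof -
  have c: "cnj c * c = 1"
    using assms complex_norm_square[of c] by (simp add: mult.commute)
  have phase: "cnj (c * a) * (c * b) = cnj a * b" for a b
  proof -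
    have "cnj (c * a) * (c * b) = (cnj c * c) * (cnj a * b)"
      by (simp add: ac_simps)
    then show ?thesis by (simp only: c mult_1)
  qed
  show ?thesis
    by (simp add: conj_transpose_def cscale_def matrix_matrix_mult_def vec_eq_iff phase
        del: complex_cnj_mult)
qed


theorem theorem3p6:
  fixes A E :: "complex^'n^'n"
    and S :: "((complex^'n^'n) \<times> (complex^'n^'n)) set"
  assumes "S \<in> {SHerm \<times> SHerm, S_even, S_odd}"
    and "(A, E) \<in> S"
    and "regular_pencil A E"
  shows "(S = SHerm \<times> SHerm \<longrightarrow>
            delta0 (SHerm \<times> SHerm) A E = delta0 (Herm \<times> Herm) (cscale \<i> A) (cscale \<i> E)
          \<and> delta0 (Herm \<times> Herm) (cscale \<i> A) (cscale \<i> E)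
              = sqrt (lambda_min (conj_transpose A ** A + conj_transpose E ** E))
          \<and> sqrt (lambda_min (conj_transpose A ** A + conj_transpose E ** E)) = delta0 UNIV A E)
       \<and> (S = S_even \<longrightarrow>
            delta0 S_even A E = delta0 (Herm \<times> Herm) A (cscale \<i> E)
          \<and> delta0 (Herm \<times> Herm) A (cscale \<i> E)
              = sqrt (lambda_min (conj_transpose A ** A + conj_transpose E ** E))
          \<and> sqrt (lambda_min (conj_transpose A ** A + conj_transpose E ** E)) = delta0 UNIV A E)
       \<and> (S = S_odd \<longrightarrow>
            delta0 S_odd A E = delta0 (Herm \<times> Herm) (cscale \<i> A) (- E)
          \<and> delta0 (Herm \<times> Herm) (cscale \<i> A) (- E)
              = sqrt (lambda_min (conj_transpose A ** A + conj_transpose E ** E))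
          \<and> sqrt (lambda_min (conj_transpose A ** A + conj_transpose E ** E)) = delta0 UNIV A E)"
proof -
  let ?r = "sqrt (lambda_min (conj_transpose A ** A + conj_transpose E ** E))"
  note structured = delta0_eq_sqrt_lambda_min[OF _ _ _ _ subset_refl]
  note unstructured = delta0_eq_sqrt_lambda_min[OF _ _ _ _ subset_UNIV]
  note H = Herm_has_minimal_interpolants
  note K = SHerm_has_minimal_interpolants
  have gram_i: "conj_transpose (cscale \<i> X) ** cscale \<i> X = conj_transpose X ** X"
    for X :: "complex^'n^'n"
    by (simp add: gram_cscale)
  have gram_minus: "conj_transpose (- X) ** (- X) = conj_transpose X ** X" for X :: "complex^'n^'n"
    by (simp add: conj_transpose_def matrix_matrix_mult_def vec_eq_iff)
  have skew: "delta0 (SHerm \<times> SHerm) A E = ?r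
      \<and> delta0 (Herm \<times> Herm) (cscale \<i> A) (cscale \<i> E) = ?r \<and> delta0 UNIV A E = ?r"
    if "A \<in> SHerm" "E \<in> SHerm"
    using structured[OF that K K] unstructured[OF that K K]
      structured[OF that[THEN cscale_i_in_Herm] H H]
    by (simp add: gram_i)
  have even: "delta0 S_even A E = ?r
      \<and> delta0 (Herm \<times> Herm) A (cscale \<i> E) = ?r \<and> delta0 UNIV A E = ?r"
    if "A \<in> Herm" "E \<in> SHerm"
    using structured[OF that H K] unstructured[OF that H K]
      structured[OF that(1) cscale_i_in_Herm[OF that(2)] H H]
    by (simp add: S_even_def gram_i)
  have odd: "delta0 S_odd A E = ?r
      \<and> delta0 (Herm \<times> Herm) (cscale \<i> A) (- E) = ?r \<and> delta0 UNIV A E = ?r"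
    if "A \<in> SHerm" "E \<in> Herm"
    using structured[OF that K H] unstructured[OF that K H]
      structured[OF cscale_i_in_Herm[OF that(1)] uminus_in_Herm[OF that(2)] H H]
    by (simp add: S_odd_def gram_i gram_minus)
  show ?thesis
    using assms(2) skew even odd by (auto simp: S_even_def S_odd_def)
qed

end
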